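(* Let $\omega=-\frac12+i\frac{\sqrt3}{2}$. Let $Q$ be a self-adjoint complex $n\times n$ matrix with $Q_{ii}=0$ for all $i$, with $Q_{i1}=Q_{1i}=1$ for all $2\le i\le n$, and with $Q_{ij}\in\{1,\omega,\omega^2\}$ for all $i\ne j$, $2\le i,j\le n$, where at least one off-diagonal entry is not equal to $1$. Let $\mu$ be a real number and define $e$ by $3e+\mu+2=n$. Then $Q^2=(n-1)I+\mu Q$ if and only if both of the following hold. (1) For each pair $i\neq j$ with $Q_{ij}=\omega$, the numbers $\alpha=\#\{k:Q_{ik}=\omega, Q_{kj}=\omega^2\}$, $\beta=\#\{k:Q_{ik}=\omega, Q_{kj}=\omega\}$, $\gamma=\#\{k:Q_{ik}=\omega, Q_{kj}=1\}$, $a=\#\{k:Q_{ik}=\omega^2, Q_{kj}=\omega^2\}$, $b=\#\{k:Q_{ik}=\omega^2, Q_{kj}=\omega\}$, $c=\#\{k:Q_{ik}=\omega^2, Q_{kj}=1\}$, $A=\#\{k:Q_{ik}=1, Q_{kj}=\omega^2\}$, $B=\#\{k:Q_{ik}=1, Q_{kj}=\omega\}$, $C=\#\{k:Q_{ik}=1, Q_{kj}=1\}$ (with $k$ ranging over $\{1,\dots,n\}$) satisfy $$\alpha-B=-\tfrac{2\mu}{3}-\tfrac13,\quad \beta-C=-\tfrac{2\mu}{3}-\tfrac43,\quad \gamma+B+C=\tfrac n3+\mu,\quad a-C=-\tfrac{\mu}{3}-\tfrac23,$$ $$b+B+C=\tfrac n3+\tfrac\mu3-\tfrac13,\quad c-B=-\tfrac\mu3+\tfrac13,\quad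 A+B+C=\tfrac n3+\tfrac{2\mu}{3}+\tfrac13 .$$ (2) For each pair $i\ne j$, $2\le i,j\le n$, with $Q_{ij}=1$, the numbers $\alpha',\beta',\gamma',a',b',c',A',B',C'$ defined for the pair $(i,j)$ by the same nine formulas as $\alpha,\beta,\gamma,a,b,c,A,B,C$, respectively, satisfy $$\alpha'=B',\quad \beta'=C'-\mu,\quad \gamma'=e+\mu-B'-C',\quad a'=C'-\mu,$$ $$b'=e+\mu-B'-C',\quad c'=B',\quad A'=e+\mu-B'-C'.$$
   Context: The nine counts depend on the pair $(i,j)$; they are not assumed to be the same for different pairs. $I$ is the $n\times n$ identity matrix. *)

theory Defs
  imports "Jordan_Normal_Form.Schur_Decomposition"
begin

text \<open>Rows and columns are indexed from 0, so the distinguished first row and column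
  have index 0, and the range from 2 to n becomes \<open>{1..<n}\<close>.\<close>

definition omega :: complex where
  "omega = - 1/2 + \<i> * complex_of_real (sqrt 3 / 2)"

text \<open>The number of \<open>k\<close> with \<open>Q\<^sub>i\<^sub>k = x\<close> and \<open>Q\<^sub>k\<^sub>j = y\<close>;
  \<open>k = i\<close> and \<open>k = j\<close> are not excluded.\<close>

definition path_count :: "complex mat \<Rightarrow> nat \<Rightarrow> nat \<Rightarrow> complex \<Rightarrow> complex \<Rightarrow> nat" where
  "path_count Q i j x y = card {k. k < dim_row Q \<and> Q $$ (i, k) = x \<and> Q $$ (k, j) = y}"

end

theory Submission
  imports Defs
begin

text \<open>Off the diagonal, \<open>Q\<^sup>2 = (n - 1) I + \<mu> Q\<close> is a statement about the inner products of
  rows of \<open>Q\<close>. Those with the first row say that every other row has sum \<open>1 + \<mu>\<close>, i.e. contains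
  \<open>e\<close> times \<open>\<omega>\<close>, \<open>e\<close> times \<open>\<omega>\<^sup>2\<close> and \<open>e + \<mu> + 1\<close> times \<open>1\<close>.
  For a fixed pair of further rows, these row and column counts together with the value of the
  inner product form, by linear independence of \<open>1\<close> and \<open>\<omega>\<close> over the reals, a linear
  system for the nine counts that is equivalent to the stated seven equations. The pairs with entry
  \<open>\<omega>\<^sup>2\<close> follow by conjugation.\<close>

section \<open>Arithmetic of the cube roots of unity\<close>

lemma omega_sq: "omega\<^sup>2 = - 1 - omega"
  by (simp add: omega_def complex_eq_iff power2_eq_square)

lemma omega_mult_omega_sq: "omega * omega\<^sup>2 = 1"
  unfolding omega_sq by (simp add: omega_def complex_eq_iff algebra_simps)

lemma omega_sq_mult_omega_sq: "omega\<^sup>2 * omega\<^sup>2 = omega"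
  by (metis omega_mult_omega_sq mult.assoc mult.left_neutral power2_eq_square)

lemma cnj_omega: "cnj omega = omega\<^sup>2"
  unfolding omega_sq by (simp add: omega_def complex_eq_iff)

lemma cnj_omega_sq: "cnj (omega\<^sup>2) = omega"
  using cnj_omega complex_cnj_cnj by metis

lemma omega_distinct:
  "omega \<noteq> 0" "omega\<^sup>2 \<noteq> 0" "omega \<noteq> 1" "omega\<^sup>2 \<noteq> 1" "omega\<^sup>2 \<noteq> omega"
  unfolding omega_sq by (simp_all add: omega_def complex_eq_iff)

text \<open>Substituting \<omega>^2 = -1 - \<omega> leaves (x - z) + (y - z) \<omega>, and \<omega>
  is not real. This is how a single complex equation becomes two real linear equations between
  counts.\<close>

lemma omega_combination_eq_0_iff:
  fixes x y z :: real
  shows "of_real x + of_real y * omega + of_real z * omega\<^sup>2 = 0 \<longleftrightarrow> x = y \<and> y = z"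
  unfolding omega_sq by (auto simp: omega_def complex_eq_iff algebra_simps)

text \<open>Expanding entries into indicators turns sums of products into counts. The value 0 gives
  a sum of zeros, so diagonal entries need no separate treatment.\<close>

lemma cube_root_decomp:
  assumes "z \<in> {0, 1, omega, omega\<^sup>2}"
  shows "z = (\<Sum>x\<in>{1, omega, omega\<^sup>2}. of_bool (z = x) * x)"
  using assms omega_distinct by auto

lemma of_bool_nonzero_cube_root:
  assumes "z \<in> {0, 1, omega, omega\<^sup>2}"
  shows "of_bool (z \<noteq> 0) = (\<Sum>x\<in>{1, omega, omega\<^sup>2}. of_bool (z = x) :: 'a :: semiring_1)"
  using assms omega_distinct by auto

section \<open>Self-adjoint matrices of cube roots of unity with a border of ones\<close>

locale cube_root_matrix =
  fixes Q :: "complex mat" and n :: nat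
  assumes carrier: "Q \<in> carrier_mat n n"
    and adjoint: "mat_adjoint Q = Q"
    and diagonal: "i < n \<Longrightarrow> Q $$ (i, i) = 0"
    and border: "i \<in> {1..<n} \<Longrightarrow> Q $$ (i, 0) = 1 \<and> Q $$ (0, i) = 1"
    and inner: "i \<in> {1..<n} \<Longrightarrow> j \<in> {1..<n} \<Longrightarrow> i \<noteq> j \<Longrightarrow> Q $$ (i, j) \<in> {1, omega, omega\<^sup>2}"
begin

lemma off_diagonal: "i < n \<Longrightarrow> j < n \<Longrightarrow> i \<noteq> j \<Longrightarrow> Q $$ (i, j) \<in> {1, omega, omega\<^sup>2}"
  using border[of i] border[of j] inner[of i j] by (cases "i = 0"; cases "j = 0") auto

lemma entries: "i < n \<Longrightarrow> j < n \<Longrightarrow> Q $$ (i, j) \<in> {0, 1, omega, omega\<^sup>2}"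
  using off_diagonal[of i j] diagonal[of i] by (cases "i = j") auto

lemma entry_nonzero_iff: "i < n \<Longrightarrow> j < n \<Longrightarrow> Q $$ (i, j) \<noteq> 0 \<longleftrightarrow> i \<noteq> j"
  using off_diagonal[of i j] diagonal[of i] omega_distinct by (cases "i = j") auto

lemma cnj_entry:
  assumes "i < n" "j < n"
  shows "cnj (Q $$ (i, j)) = Q $$ (j, i)"
proof -
  have "mat_adjoint Q $$ (j, i) = cnj (Q $$ (i, j))"
    using assms carrier by (simp add: mat_adjoint_def mat_of_rows_index)
  then show ?thesis by (simp add: adjoint)
qed

section \<open>Entries of the square and row sums\<close>

definition square_entry :: "nat \<Rightarrow> nat \<Rightarrow> complex" where
  "square_entry i j = (\<Sum>k<n. Q $$ (i, k) * Q $$ (k, j))"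

definition row_sum :: "nat \<Rightarrow> complex" where
  "row_sum i = (\<Sum>k<n. Q $$ (i, k))"

definition row_count :: "nat \<Rightarrow> complex \<Rightarrow> nat" where
  "row_count i x = card {k. k < n \<and> Q $$ (i, k) = x}"

lemma index_square: "i < n \<Longrightarrow> j < n \<Longrightarrow> (Q ^\<^sub>m 2) $$ (i, j) = square_entry i j"
  using carrier
  by (simp add: numeral_2_eq_2 square_entry_def scalar_prod_def atLeast0LessThan)

text \<open>Each term is |Q_ik|^2, which is 1 off the diagonal and 0 at k = i. The diagonal part of
  the matrix equation therefore holds automatically.\<close>

lemma square_entry_diagonal:
  assumes "i < n"
  shows "square_entry i i = of_nat (n - 1)"
proof -
  have "Q $$ (i, k) * Q $$ (k, i) = of_bool (k \<noteq> i)" if "k < n" for k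
  proof -
    have "Q $$ (i, k) * Q $$ (k, i) = Q $$ (i, k) * cnj (Q $$ (i, k))"
      using that assms by (simp add: cnj_entry)
    also have "\<dots> = of_bool (Q $$ (i, k) \<noteq> 0)"
      using entries[OF assms that] omega_distinct
      by (auto simp: cnj_omega cnj_omega_sq omega_mult_omega_sq mult.commute[of "omega\<^sup>2"]
          simp del: complex_cnj_power)
    finally show ?thesis using that assms by (auto simp: entry_nonzero_iff)
  qed
  then have "square_entry i i = (\<Sum>k<n. of_bool (k \<noteq> i))"
    by (simp add: square_entry_def)
  also have "\<dots> = of_nat (card ({..<n} - {i}))"
    by (simp add: of_bool_def sum.If_cases Diff_eq Collect_neg_eq)
  finally show ?thesis using assms by simp
qed

lemma square_entry_sym: "i < n \<Longrightarrow> j < n \<Longrightarrow> square_entry j i = cnj (square_entry i j)"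
  by (simp add: square_entry_def cnj_entry mult.commute)

text \<open>Column 0 consists of ones except for its zero at k = 0, so multiplying by it sums row i
  without the term Q_i0 = 1.\<close>

lemma square_entry_border:
  assumes "i \<in> {1..<n}"
  shows "square_entry i 0 = row_sum i - 1" "square_entry 0 i = cnj (row_sum i - 1)"
proof -
  from assms have "0 < n" by auto
  have "Q $$ (i, k) * Q $$ (k, 0) = Q $$ (i, k) - of_bool (k = 0)" if "k < n" for k
    using that assms border[of k] border[of i] diagonal[of 0] by (cases "k = 0") auto
  then have "square_entry i 0 = row_sum i - (\<Sum>k<n. of_bool (k = 0))"
    unfolding square_entry_def row_sum_def sum_subtractf[symmetric] by (intro sum.cong) auto
  also have "(\<Sum>k<n. of_bool (k = 0)) = (1 :: complex)"
    using \<open>0 < n\<close> by (simp add: Int_absorb1)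
  finally show *: "square_entry i 0 = row_sum i - 1" .
  show "square_entry 0 i = cnj (row_sum i - 1)"
    using square_entry_sym[of i 0] assms * by simp
qed

section \<open>Counts as sums of indicators\<close>

lemma path_count_eq_sum:
  "(of_nat (path_count Q i j x y) :: 'a :: semiring_1) =
    (\<Sum>k<n. of_bool (Q $$ (i, k) = x) * of_bool (Q $$ (k, j) = y))"
proof -
  have "{k. k < n \<and> Q $$ (i, k) = x \<and> Q $$ (k, j) = y} =
      {..<n} \<inter> {k. Q $$ (i, k) = x \<and> Q $$ (k, j) = y}" by auto
  then show ?thesis
    using carrier by (simp add: path_count_def flip: of_bool_conj)
qed

lemma row_count_eq_sum: "(of_nat (row_count i x) :: 'a :: semiring_1) = (\<Sum>k<n. of_bool (Q $$ (i, k) = x))"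
  by (simp add: row_count_def of_bool_def sum.If_cases Int_def lessThan_def)

text \<open>The indices k are grouped by the pair of values (Q_ik, Q_kj): both factors are expanded
  into indicators and the sum over k is moved innermost.\<close>

lemma square_entry_eq_path_counts:
  assumes "i < n" "j < n"
  shows "square_entry i j =
    (\<Sum>x\<in>{1, omega, omega\<^sup>2}. \<Sum>y\<in>{1, omega, omega\<^sup>2}. of_nat (path_count Q i j x y) * (x * y))"
proof -
  let ?T = "{1, omega, omega\<^sup>2}"
  let ?d = "\<lambda>k x y. of_bool (Q $$ (i, k) = x) * of_bool (Q $$ (k, j) = y) * (x * y) :: complex"
  have "Q $$ (i, k) * Q $$ (k, j) = (\<Sum>x\<in>?T. \<Sum>y\<in>?T. ?d k x y)" if "k < n" for k
  proof -
    have "Q $$ (i, k) * Q $$ (k, j) =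
        (\<Sum>x\<in>?T. of_bool (Q $$ (i, k) = x) * x) * (\<Sum>y\<in>?T. of_bool (Q $$ (k, j) = y) * y)"
      using cube_root_decomp[OF entries[OF assms(1) that]]
        cube_root_decomp[OF entries[OF that assms(2)]] by (rule arg_cong2)
    also have "\<dots> = (\<Sum>x\<in>?T. \<Sum>y\<in>?T. ?d k x y)"
      unfolding sum_product by (simp only: mult_ac)
    finally show ?thesis .
  qed
  then have "square_entry i j = (\<Sum>k<n. \<Sum>x\<in>?T. \<Sum>y\<in>?T. ?d k x y)"
    unfolding square_entry_def by (intro sum.cong) auto
  also have "\<dots> = (\<Sum>x\<in>?T. \<Sum>k<n. \<Sum>y\<in>?T. ?d k x y)"
    by (rule sum.swap)
  also have "\<dots> = (\<Sum>x\<in>?T. \<Sum>y\<in>?T. \<Sum>k<n. ?d k x y)"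
    by (intro sum.cong sum.swap refl)
  also have "\<dots> = (\<Sum>x\<in>?T. \<Sum>y\<in>?T. of_nat (path_count Q i j x y) * (x * y))"
    by (simp only: path_count_eq_sum sum_distrib_right)
  finally show ?thesis .
qed

lemma row_sum_eq_row_counts:
  assumes "i < n"
  shows "row_sum i = (\<Sum>x\<in>{1, omega, omega\<^sup>2}. of_nat (row_count i x) * x)"
proof -
  let ?T = "{1, omega, omega\<^sup>2}"
  have "row_sum i = (\<Sum>k<n. \<Sum>x\<in>?T. of_bool (Q $$ (i, k) = x) * x)"
    unfolding row_sum_def using cube_root_decomp[OF entries[OF assms]] by (intro sum.cong) auto
  also have "\<dots> = (\<Sum>x\<in>?T. \<Sum>k<n. of_bool (Q $$ (i, k) = x) * x)"
    by (rule sum.swap)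
  also have "\<dots> = (\<Sum>x\<in>?T. of_nat (row_count i x) * x)"
    by (simp only: row_count_eq_sum sum_distrib_right)
  finally show ?thesis .
qed

text \<open>The value 0 occurs exactly once in a row, on the diagonal.\<close>

lemma sum_row_counts:
  assumes "i < n"
  shows "(\<Sum>x\<in>{1, omega, omega\<^sup>2}. row_count i x) = n - 1"
proof -
  let ?T = "{1, omega, omega\<^sup>2}"
  have "(\<Sum>x\<in>?T. row_count i x) = (\<Sum>x\<in>?T. \<Sum>k<n. of_bool (Q $$ (i, k) = x))"
    using row_count_eq_sum[of i, where 'a = nat] by simp
  also have "\<dots> = (\<Sum>k<n. \<Sum>x\<in>?T. of_bool (Q $$ (i, k) = x))"
    by (rule sum.swap)
  also have "\<dots> = (\<Sum>k<n. of_bool (Q $$ (i, k) \<noteq> 0))"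
    using of_bool_nonzero_cube_root[OF entries[OF assms], where 'a = nat]
    by (intro sum.cong) auto
  also have "\<dots> = (\<Sum>k<n. of_bool (k \<noteq> i))"
    using assms by (intro sum.cong) (auto simp: entry_nonzero_iff)
  also have "\<dots> = card ({..<n} - {i})"
    by (simp add: of_bool_def sum.If_cases Diff_eq Collect_neg_eq)
  finally show ?thesis using assms by simp
qed

text \<open>The k with Q_ik = x are split by the value of Q_kj. Since y runs over nonzero values
  only, k = j is missed because Q_jj = 0; the indicator restores it.\<close>

lemma row_count_eq_path_counts:
  assumes "i < n" "j < n"
  shows "row_count i x = (\<Sum>y\<in>{1, omega, omega\<^sup>2}. path_count Q i j x y) + of_bool (Q $$ (i, j) = x)"
proof -
  let ?T = "{1, omega, omega\<^sup>2}"
  have "(\<Sum>y\<in>?T. path_count Q i j x y) =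
      (\<Sum>y\<in>?T. \<Sum>k<n. of_bool (Q $$ (i, k) = x) * of_bool (Q $$ (k, j) = y))"
    using path_count_eq_sum[of i j, where 'a = nat] by simp
  also have "\<dots> = (\<Sum>k<n. \<Sum>y\<in>?T. of_bool (Q $$ (i, k) = x) * of_bool (Q $$ (k, j) = y))"
    by (rule sum.swap)
  also have "\<dots> = (\<Sum>k<n. of_bool (Q $$ (i, k) = x) * of_bool (Q $$ (k, j) \<noteq> 0))"
    using of_bool_nonzero_cube_root[OF entries[OF _ assms(2)], where 'a = nat]
    by (intro sum.cong) (simp_all only: sum_distrib_left lessThan_iff)
  also have "\<dots> = (\<Sum>k\<in>{..<n} - {j}. of_bool (Q $$ (i, k) = x))"
    using assms by (intro sum.mono_neutral_cong_right) (auto simp: entry_nonzero_iff)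
  finally show ?thesis
    using assms row_count_eq_sum[of i x, where 'a = nat]
    by (simp add: sum.remove[of "{..<n}" j] del: sum_of_bool_eq)
qed

text \<open>Self-adjointness reverses the path from i through k to j and conjugates both entries.
  This gives column counts from row counts.\<close>

lemma path_count_sym:
  assumes "i < n" "j < n"
  shows "path_count Q i j x y = path_count Q j i (cnj y) (cnj x)"
proof -
  have "k < n \<Longrightarrow> Q $$ (j, k) = cnj y \<longleftrightarrow> Q $$ (k, j) = y"
    "k < n \<Longrightarrow> Q $$ (k, i) = cnj x \<longleftrightarrow> Q $$ (i, k) = x" for k
    using assms cnj_entry by (metis complex_cnj_cnj)+
  then have "{k. k < n \<and> Q $$ (i, k) = x \<and> Q $$ (k, j) = y} =
      {k. k < n \<and> Q $$ (j, k) = cnj y \<and> Q $$ (k, i) = cnj x}" by auto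
  then show ?thesis using carrier by (simp add: path_count_def)
qed

section \<open>Linear systems for the counts\<close>

text \<open>The complex equation makes the counts of \<omega> and \<omega>^2 equal to a common t and
  the count of 1 equal to t + \<mu> + 1. The total n - 1 = 3e + \<mu> + 1 then forces t = e.\<close>

lemma row_sum_eq_iff:
  fixes e \<mu> :: real
  assumes "i < n" "3 * e + \<mu> + 2 = real n"
  shows "row_sum i = 1 + of_real \<mu> \<longleftrightarrow>
    row_count i 1 = e + \<mu> + 1 \<and> row_count i omega = e \<and> row_count i (omega\<^sup>2) = e"
proof -
  have total: "real (row_count i 1) + row_count i omega + row_count i (omega\<^sup>2) = real n - 1"
    using sum_row_counts[OF assms(1)] assms(1) omega_distinct by auto
  have "row_sum i = 1 + of_real \<mu> \<longleftrightarrow>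
      of_real (real (row_count i 1) - 1 - \<mu>) + of_real (row_count i omega) * omega
        + of_real (row_count i (omega\<^sup>2)) * omega\<^sup>2 = 0"
    using row_sum_eq_row_counts[OF assms(1)] omega_distinct by (auto simp: algebra_simps)
  then show ?thesis
    unfolding omega_combination_eq_0_iff using total assms(2) by auto
qed

lemma row_counts:
  assumes "i < n" "j < n"
  shows
    "row_count i 1 = path_count Q i j 1 (omega\<^sup>2) + path_count Q i j 1 omega + path_count Q i j 1 1
      + of_bool (Q $$ (i, j) = 1)"
    "row_count i omega = path_count Q i j omega (omega\<^sup>2) + path_count Q i j omega omega
      + path_count Q i j omega 1 + of_bool (Q $$ (i, j) = omega)"
    "row_count i (omega\<^sup>2) = path_count Q i j (omega\<^sup>2) (omega\<^sup>2) + path_count Q i j (omega\<^sup>2) omega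
      + path_count Q i j (omega\<^sup>2) 1 + of_bool (Q $$ (i, j) = omega\<^sup>2)"
  using row_count_eq_path_counts[OF assms] omega_distinct by auto

text \<open>Conjugation exchanges \<open>\<omega>\<close> and \<open>\<omega>\<^sup>2\<close>, so \<open>\<omega>\<close> in row \<open>j\<close>
  is counted by \<open>\<omega>\<^sup>2\<close> in column \<open>j\<close>.\<close>

lemma column_counts:
  assumes "i < n" "j < n"
  shows
    "row_count j 1 = path_count Q i j (omega\<^sup>2) 1 + path_count Q i j omega 1 + path_count Q i j 1 1
      + of_bool (Q $$ (i, j) = 1)"
    "row_count j omega = path_count Q i j (omega\<^sup>2) (omega\<^sup>2) + path_count Q i j omega (omega\<^sup>2)
      + path_count Q i j 1 (omega\<^sup>2) + of_bool (Q $$ (i, j) = omega\<^sup>2)"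
    "row_count j (omega\<^sup>2) = path_count Q i j (omega\<^sup>2) omega + path_count Q i j omega omega
      + path_count Q i j 1 omega + of_bool (Q $$ (i, j) = omega)"
proof -
  have "Q $$ (j, i) = 1 \<longleftrightarrow> Q $$ (i, j) = 1" "Q $$ (j, i) = omega \<longleftrightarrow> Q $$ (i, j) = omega\<^sup>2"
    "Q $$ (j, i) = omega\<^sup>2 \<longleftrightarrow> Q $$ (i, j) = omega"
    using cnj_entry[OF assms] by (metis cnj_omega cnj_omega_sq complex_cnj_one complex_cnj_cnj)+
  then show
    "row_count j 1 = path_count Q i j (omega\<^sup>2) 1 + path_count Q i j omega 1 + path_count Q i j 1 1
      + of_bool (Q $$ (i, j) = 1)"
    "row_count j omega = path_count Q i j (omega\<^sup>2) (omega\<^sup>2) + path_count Q i j omega (omega\<^sup>2)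
      + path_count Q i j 1 (omega\<^sup>2) + of_bool (Q $$ (i, j) = omega\<^sup>2)"
    "row_count j (omega\<^sup>2) = path_count Q i j (omega\<^sup>2) omega + path_count Q i j omega omega
      + path_count Q i j 1 omega + of_bool (Q $$ (i, j) = omega)"
    using row_counts[OF assms(2,1)]
    by (simp_all add: path_count_sym[OF assms] cnj_omega cnj_omega_sq del: complex_cnj_power)
qed

text \<open>The nine products are collected by their exponent of \<omega> modulo 3.\<close>

lemma square_entry_eq:
  assumes "i < n" "j < n"
  shows "square_entry i j =
    of_real (path_count Q i j omega (omega\<^sup>2) + path_count Q i j (omega\<^sup>2) omega + path_count Q i j 1 1)
    + of_real (path_count Q i j (omega\<^sup>2) (omega\<^sup>2) + path_count Q i j omega 1 + path_count Q i j 1 omega)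
      * omega
    + of_real (path_count Q i j omega omega + path_count Q i j (omega\<^sup>2) 1 + path_count Q i j 1 (omega\<^sup>2))
      * omega\<^sup>2"
proof -
  have "omega\<^sup>2 * omega = 1" using omega_mult_omega_sq by (simp only: mult.commute)
  moreover have "omega * omega = omega\<^sup>2" by (simp only: power2_eq_square)
  moreover have "sum f {1, omega, omega\<^sup>2} = f 1 + (f omega + f (omega\<^sup>2))"
    for f :: "complex \<Rightarrow> complex" using omega_distinct by simp
  ultimately show ?thesis
    unfolding square_entry_eq_path_counts[OF assms]
    by (simp only: omega_mult_omega_sq omega_sq_mult_omega_sq mult_1_left mult_1_right
        of_nat_add of_real_of_nat_eq of_real_add) (simp only: algebra_simps)
qed

text \<open>Three row equations, three column equations and two from the inner product constrain
  nine unknowns. Rows and columns have the same total, so the rank is seven, and the stated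
  equations solve for everything in terms of \<open>B\<close> and \<open>C\<close>. In particular
  they imply both row sums.\<close>

lemma omega_counts_iff:
  fixes e \<mu> :: real
  assumes ij: "i < n" "j < n" and Qij: "Q $$ (i, j) = omega" and e: "3 * e + \<mu> + 2 = real n"
  shows "row_sum i = 1 + of_real \<mu> \<and> row_sum j = 1 + of_real \<mu> \<and>
      square_entry i j = of_real \<mu> * Q $$ (i, j) \<longleftrightarrow>
    (let \<alpha> = real (path_count Q i j omega (omega^2));
         \<beta> = real (path_count Q i j omega omega);
         \<gamma> = real (path_count Q i j omega 1);
         a = real (path_count Q i j (omega^2) (omega^2));
         b = real (path_count Q i j (omega^2) omega);
         c = real (path_count Q i j (omega^2) 1);
         A = real (path_count Q i j 1 (omega^2));
         B = real (path_count Q i j 1 omega);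
         C = real (path_count Q i j 1 1)
     in \<alpha> - B = - (2 * \<mu> / 3) - 1/3 \<and>
        \<beta> - C = - (2 * \<mu> / 3) - 4/3 \<and>
        \<gamma> + B + C = real n / 3 + \<mu> \<and>
        a - C = - (\<mu> / 3) - 2/3 \<and>
        b + B + C = real n / 3 + \<mu> / 3 - 1/3 \<and>
        c - B = - (\<mu> / 3) + 1/3 \<and>
        A + B + C = real n / 3 + 2 * \<mu> / 3 + 1/3)"
proof -
  \<comment> \<open>Since Q_ij = \<omega>, moving the right-hand side over subtracts \<mu> from the
    coefficient of \<omega>.\<close>
  have sq: "square_entry i j = of_real \<mu> * Q $$ (i, j) \<longleftrightarrow>
    of_real (path_count Q i j omega (omega\<^sup>2) + path_count Q i j (omega\<^sup>2) omega + path_count Q i j 1 1)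
    + of_real (path_count Q i j (omega\<^sup>2) (omega\<^sup>2) + path_count Q i j omega 1 + path_count Q i j 1 omega - \<mu>)
      * omega
    + of_real (path_count Q i j omega omega + path_count Q i j (omega\<^sup>2) 1 + path_count Q i j 1 (omega\<^sup>2))
      * omega\<^sup>2 = 0"
    unfolding square_entry_eq[OF ij] Qij by (auto simp: algebra_simps)
  show ?thesis
    unfolding sq
    unfolding omega_combination_eq_0_iff row_sum_eq_iff[OF ij(1) e] row_sum_eq_iff[OF ij(2) e]
      row_counts[OF ij] column_counts[OF ij] Let_def Qij
    using e
    \<comment> \<open>With Q_ij known, the indicators become numbers: one extra \<omega> in row i
      and one extra \<omega>^2 in row j. What remains is real linear arithmetic.\<close>
    by (simp only: of_nat_add simp_thms of_bool_eq omega_distinct omega_distinct[symmetric] of_nat_0 of_nat_1)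
      (intro iffI; elim conjE; intro conjI; linarith)
qed

text \<open>The same system, except that the extra entry is now a 1 in both rows and \<mu> enters
  the constant coefficient.\<close>

lemma one_counts_iff:
  fixes e \<mu> :: real
  assumes ij: "i < n" "j < n" and Qij: "Q $$ (i, j) = 1" and e: "3 * e + \<mu> + 2 = real n"
  shows "row_sum i = 1 + of_real \<mu> \<and> row_sum j = 1 + of_real \<mu> \<and>
      square_entry i j = of_real \<mu> * Q $$ (i, j) \<longleftrightarrow>
    (let \<alpha>' = real (path_count Q i j omega (omega^2));
         \<beta>' = real (path_count Q i j omega omega);
         \<gamma>' = real (path_count Q i j omega 1);
         a' = real (path_count Q i j (omega^2) (omega^2));
         b' = real (path_count Q i j (omega^2) omega);
         c' = real (path_count Q i j (omega^2) 1);
         A' = real (path_count Q i j 1 (omega^2));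
         B' = real (path_count Q i j 1 omega);
         C' = real (path_count Q i j 1 1)
     in \<alpha>' = B' \<and>
        \<beta>' = C' - \<mu> \<and>
        \<gamma>' = e + \<mu> - B' - C' \<and>
        a' = C' - \<mu> \<and>
        b' = e + \<mu> - B' - C' \<and>
        c' = B' \<and>
        A' = e + \<mu> - B' - C')"
proof -
  have sq: "square_entry i j = of_real \<mu> * Q $$ (i, j) \<longleftrightarrow>
    of_real (path_count Q i j omega (omega\<^sup>2) + path_count Q i j (omega\<^sup>2) omega + path_count Q i j 1 1 - \<mu>)
    + of_real (path_count Q i j (omega\<^sup>2) (omega\<^sup>2) + path_count Q i j omega 1 + path_count Q i j 1 omega)
      * omega
    + of_real (path_count Q i j omega omega + path_count Q i j (omega\<^sup>2) 1 + path_count Q i j 1 (omega\<^sup>2))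
      * omega\<^sup>2 = 0"
    unfolding square_entry_eq[OF ij] Qij by (auto simp: algebra_simps)
  show ?thesis
    unfolding sq
    unfolding omega_combination_eq_0_iff row_sum_eq_iff[OF ij(1) e] row_sum_eq_iff[OF ij(2) e]
      row_counts[OF ij] column_counts[OF ij] Let_def Qij
    using e
    by (simp only: of_nat_add simp_thms of_bool_eq omega_distinct omega_distinct[symmetric] of_nat_0 of_nat_1)
      (intro iffI; elim conjE; intro conjI; linarith)
qed

section \<open>Reduction of the matrix equation to pairs of inner indices\<close>

lemma square_eq_iff:
  "Q ^\<^sub>m 2 = complex_of_real (real n - 1) \<cdot>\<^sub>m 1\<^sub>m n + complex_of_real \<mu> \<cdot>\<^sub>m Q \<longleftrightarrow>
    (\<forall>i<n. \<forall>j<n. i \<noteq> j \<longrightarrow> square_entry i j = of_real \<mu> * Q $$ (i, j))"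
    (is "?L = ?R \<longleftrightarrow> ?offdiag")
proof -
  have "?L = ?R \<longleftrightarrow> (\<forall>i<n. \<forall>j<n. ?L $$ (i, j) = ?R $$ (i, j))"
    using carrier by (auto intro!: eq_matI)
  also have "\<dots> \<longleftrightarrow> ?offdiag"
  proof -
    have "?L $$ (i, i) = ?R $$ (i, i)" if "i < n" for i
      using that carrier by (simp add: index_square square_entry_diagonal diagonal of_nat_diff)
    moreover have "?L $$ (i, j) = square_entry i j" "?R $$ (i, j) = of_real \<mu> * Q $$ (i, j)"
      if "i < n" "j < n" "i \<noteq> j" for i j
      using that carrier by (simp_all add: index_square)
    ultimately show ?thesis by metis
  qed
  finally show ?thesis .
qed

text \<open>The border equations are exactly the row sum conditions; \<mu> is real, so row 0 and
  column 0 say the same. Attaching these conditions to each pair gives the form treated by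
  \<open>omega_counts_iff\<close> and \<open>one_counts_iff\<close>.\<close>

lemma square_eq_iff_inner:
  assumes "3 \<le> n"
  shows "Q ^\<^sub>m 2 = complex_of_real (real n - 1) \<cdot>\<^sub>m 1\<^sub>m n + complex_of_real \<mu> \<cdot>\<^sub>m Q \<longleftrightarrow>
    (\<forall>i\<in>{1..<n}. \<forall>j\<in>{1..<n}. i \<noteq> j \<longrightarrow> row_sum i = 1 + of_real \<mu> \<and> row_sum j = 1 + of_real \<mu> \<and>
      square_entry i j = of_real \<mu> * Q $$ (i, j))" (is "_ \<longleftrightarrow> ?inner")
  unfolding square_eq_iff
proof
  assume *: "\<forall>i<n. \<forall>j<n. i \<noteq> j \<longrightarrow> square_entry i j = of_real \<mu> * Q $$ (i, j)"
  have "row_sum i = 1 + of_real \<mu>" if "i \<in> {1..<n}" for i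
    using *[rule_format, of i 0] that border[of i] square_entry_border[of i]
    by (auto simp: algebra_simps)
  with * show ?inner by auto
next
  assume *: ?inner
  have row: "row_sum i = 1 + of_real \<mu>" if "i \<in> {1..<n}" for i
  proof -
    \<comment> \<open>A row sum condition is available only through a pair, so a second inner index
      is required; \<open>3 \<le> n\<close> provides 1 or 2.\<close>
    obtain j where "j \<in> {1..<n}" "i \<noteq> j"
      using assms that by (cases "i = 1") (auto intro: that[of 1] that[of 2])
    with * that show ?thesis by blast
  qed
  show "\<forall>i<n. \<forall>j<n. i \<noteq> j \<longrightarrow> square_entry i j = of_real \<mu> * Q $$ (i, j)"
  proof (intro allI impI)
    fix i j assume ij: "i < n" "j < n" "i \<noteq> j"
    consider "i = 0" "j \<in> {1..<n}" | "j = 0" "i \<in> {1..<n}" | "i \<in> {1..<n}" "j \<in> {1..<n}"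
      using ij by force
    then show "square_entry i j = of_real \<mu> * Q $$ (i, j)"
      using ij * by cases (simp_all add: row square_entry_border border)
  qed
qed

end

section \<open>From pairs of indices to the two families of count equations\<close>

theorem theorem3p1:
  fixes Q :: "complex mat" and n :: nat and \<mu> e :: real
  assumes "Q \<in> carrier_mat n n"
    and "mat_adjoint Q = Q"
    and "\<forall>i<n. Q $$ (i, i) = 0"
    and "\<forall>i\<in>{1..<n}. Q $$ (i, 0) = 1 \<and> Q $$ (0, i) = 1"
    and "\<forall>i\<in>{1..<n}. \<forall>j\<in>{1..<n}. i \<noteq> j \<longrightarrow> Q $$ (i, j) \<in> {1, omega, omega^2}"
    and "\<exists>i<n. \<exists>j<n. i \<noteq> j \<and> Q $$ (i, j) \<noteq> 1"
    and "3 * e + \<mu> + 2 = real n"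
  shows "Q ^\<^sub>m 2 = complex_of_real (real n - 1) \<cdot>\<^sub>m 1\<^sub>m n + complex_of_real \<mu> \<cdot>\<^sub>m Q \<longleftrightarrow>
    (\<forall>i<n. \<forall>j<n. i \<noteq> j \<and> Q $$ (i, j) = omega \<longrightarrow>
      (let \<alpha> = real (path_count Q i j omega (omega^2));
           \<beta> = real (path_count Q i j omega omega);
           \<gamma> = real (path_count Q i j omega 1);
           a = real (path_count Q i j (omega^2) (omega^2));
           b = real (path_count Q i j (omega^2) omega);
           c = real (path_count Q i j (omega^2) 1);
           A = real (path_count Q i j 1 (omega^2));
           B = real (path_count Q i j 1 omega);
           C = real (path_count Q i j 1 1)
       in \<alpha> - B = - (2 * \<mu> / 3) - 1/3 \<and>
          \<beta> - C = - (2 * \<mu> / 3) - 4/3 \<and>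
          \<gamma> + B + C = real n / 3 + \<mu> \<and>
          a - C = - (\<mu> / 3) - 2/3 \<and>
          b + B + C = real n / 3 + \<mu> / 3 - 1/3 \<and>
          c - B = - (\<mu> / 3) + 1/3 \<and>
          A + B + C = real n / 3 + 2 * \<mu> / 3 + 1/3)) \<and>
    (\<forall>i\<in>{1..<n}. \<forall>j\<in>{1..<n}. i \<noteq> j \<and> Q $$ (i, j) = 1 \<longrightarrow>
      (let \<alpha>' = real (path_count Q i j omega (omega^2));
           \<beta>' = real (path_count Q i j omega omega);
           \<gamma>' = real (path_count Q i j omega 1);
           a' = real (path_count Q i j (omega^2) (omega^2));
           b' = real (path_count Q i j (omega^2) omega);
           c' = real (path_count Q i j (omega^2) 1);
           A' = real (path_count Q i j 1 (omega^2));
           B' = real (path_count Q i j 1 omega);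
           C' = real (path_count Q i j 1 1)
       in \<alpha>' = B' \<and>
          \<beta>' = C' - \<mu> \<and>
          \<gamma>' = e + \<mu> - B' - C' \<and>
          a' = C' - \<mu> \<and>
          b' = e + \<mu> - B' - C' \<and>
          c' = B' \<and>
          A' = e + \<mu> - B' - C'))"
    (is "_ \<longleftrightarrow> ?rhs")
proof -
  interpret cube_root_matrix Q n
    using assms by unfold_locales auto
  let ?P = "\<lambda>i j. row_sum i = 1 + of_real \<mu> \<and> row_sum j = 1 + of_real \<mu> \<and>
      square_entry i j = of_real \<mu> * Q $$ (i, j)"
  obtain i j where ij: "i < n" "j < n" "i \<noteq> j" "Q $$ (i, j) \<noteq> 1"
    using assms(6) by auto
  \<comment> \<open>Border entries equal 1, so an off-diagonal entry other than 1 yields two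
    distinct inner indices and hence \<open>3 \<le> n\<close>.\<close>
  then have "i \<noteq> 0 \<and> j \<noteq> 0"
    using border[of i] border[of j] by (cases "i = 0"; cases "j = 0") auto
  with ij have "3 \<le> n" by auto
  \<comment> \<open>The square is self-adjoint and \<mu> is real, so the equations at (i, j) and (j,
    i) are conjugate.\<close>
  have swap: "?P i j \<longleftrightarrow> ?P j i" if "i < n" "j < n" for i j
  proof -
    have "square_entry j i = of_real \<mu> * Q $$ (j, i) \<longleftrightarrow>
        cnj (square_entry i j) = cnj (of_real \<mu> * Q $$ (i, j))"
      using that by (simp add: square_entry_sym[OF that] cnj_entry)
    then show ?thesis unfolding complex_cnj_cancel_iff by blast
  qed
  \<comment> \<open>The first family ranges over all indices, but \<omega> never occurs on the
    border.\<close>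
  have omega_pos: "i \<in> {1..<n} \<and> j \<in> {1..<n}" if "i < n" "j < n" "i \<noteq> j" "Q $$ (i, j) = omega" for i j
    using that border[of i] border[of j] omega_distinct by (cases "i = 0"; cases "j = 0") auto
  have "(\<forall>i\<in>{1..<n}. \<forall>j\<in>{1..<n}. i \<noteq> j \<longrightarrow> ?P i j) \<longleftrightarrow>
      (\<forall>i<n. \<forall>j<n. i \<noteq> j \<and> Q $$ (i, j) = omega \<longrightarrow> ?P i j) \<and>
      (\<forall>i\<in>{1..<n}. \<forall>j\<in>{1..<n}. i \<noteq> j \<and> Q $$ (i, j) = 1 \<longrightarrow> ?P i j)" (is "?all \<longleftrightarrow> ?om \<and> ?one")
  proof
    assume ?all
    then show "?om \<and> ?one" using omega_pos by blast
  next
    assume *: "?om \<and> ?one"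
    show ?all
    proof (intro ballI impI)
      fix i j assume ij: "i \<in> {1..<n}" "j \<in> {1..<n}" "i \<noteq> j"
      then have lt: "i < n" "j < n" by auto
      consider "Q $$ (i, j) = 1" | "Q $$ (i, j) = omega" | "Q $$ (i, j) = omega\<^sup>2"
        using inner[OF ij] by blast
      then show "?P i j"
      proof cases
        \<comment> \<open>No count equations are stated for entries \<omega>^2; the transposed pair
          has entry \<omega> and carries the same condition.\<close>
        case 3
        then have "Q $$ (j, i) = omega"
          using cnj_entry[OF lt] cnj_omega_sq by metis
        with * lt ij have "?P j i" by blast
        then show ?thesis using swap[OF lt] by blast
      qed (use * ij lt in blast)+
    qed
  qed
  also have "\<dots> \<longleftrightarrow> ?rhs"
    by (intro arg_cong2[where f = "(\<and>)"] all_cong1 ball_cong imp_cong refl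
        omega_counts_iff[OF _ _ _ assms(7)] one_counts_iff[OF _ _ _ assms(7)]) auto
  finally show ?thesis
    unfolding square_eq_iff_inner[OF \<open>3 \<le> n\<close>] .
qed

end
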